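(* In the Pearson setting described in the context, with $\tilde M^{\mathsf L}_n(z)=zM^{\mathsf L}_n(z)$ and $\tilde M^{\mathsf R}_n(z)=zM^{\mathsf R}_n(z)$, where $M^{\mathsf L}_n=(Z^{\mathsf L}_n)'(Z^{\mathsf L}_n)^{-1}$ and $M^{\mathsf R}_n=(Z^{\mathsf R}_n)^{-1}(Z^{\mathsf R}_n)'$ are the structure matrices, one has for every $n\in\mathbb N$ $$z\big(Y^{\mathsf L}_n\big)'(z)+Y^{\mathsf L}_n(z)\begin{bmatrix}h^{\mathsf L}(z)&0_N\\0_N&-h^{\mathsf R}(z)\end{bmatrix}=\tilde M^{\mathsf L}_n(z)Y^{\mathsf L}_n(z),$$ $$z\big(Y^{\mathsf R}_n\big)'(z)+\begin{bmatrix}h^{\mathsf R}(z)&0_N\\0_N&-h^{\mathsf L}(z)\end{bmatrix}Y^{\mathsf R}_n(z)=Y^{\mathsf R}_n(z)\tilde M^{\mathsf R}_n(z).$$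
   Context: $N\ge1$ is fixed, $\mathbb N=\{0,1,2,\dots\}$, $I_N$ and $0_N$ are the $N\times N$ identity and zero matrices. Curve: $\gamma\subset\mathbb C$ is a non self-intersecting smooth curve with one end point at $0$ and the other at $\infty$, meeting each circle $|z|=R$, $R>0$, exactly once. It is oriented from $0$ to $\infty$; the subscripts $+$ and $-$ denote boundary values on $\gamma$ from its left and right sides. $\log z$ is a branch on $\mathbb C\setminus\gamma$ and $z^A=e^{A\log z}$. Laguerre type matrix of weights: an $N\times N$ matrix function $W$ on $\gamma$, all of whose moments $W_n=\frac1{2\pi i}\int_\gamma z^nW(z)\,dz$ exist, with entries of the form $W^{(j,k)}(z)=\sum_{m\in I_{j,k}}h_m(z)z^{\alpha_m}\log^{p_m}z$, $z\in\gamma$, where $I_{j,k}$ is a finite index set, $\alpha_m>-1$, $p_m\in\mathbb N$, and $h_m$ is Hölder continuous, bounded and non-vanishing on $\gamma$, with a holomorphic extension to $\mathbb C$. It is regular if $\det[W_{j+k}]_{j,k=0,\dots,n}\ne0$ for all $n\in\mathbb N$. Pearson setting: $h^{\mathsf L},h^{\mathsf R}$ are $N\times N$ matrices of entire functions; $W^{\mathsf L},W^{\mathsf R}$ are invertible holomorphic solutions on $\mathbb C\setminus\gamma$ of $z(W^{\mathsf L})'=h^{\mathsf L}W^{\mathsf L}$, $z(W^{\mathsf R})'=W^{\mathsf R}h^{\mathsf R}$, written as $W^{\mathsf L}(z)=H^{\mathsf L}(z)z^{A^{\mathsf L}}W_0^{\mathsf L}$ and $W^{\mathsf R}(z)=W_0^{\mathsf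 R}z^{A^{\mathsf R}}H^{\mathsf R}(z)$, where $W_0^{\mathsf L},W_0^{\mathsf R}$ are constant nonsingular matrices, $H^{\mathsf L},H^{\mathsf R}$ are entire and nonsingular for $z\neq0$, and $A^{\mathsf L},A^{\mathsf R}$ are constant matrices with real spectra contained in $(-1,\infty)$. The weight is $W=(W^{\mathsf L}W^{\mathsf R})_+$ on $\gamma$, assumed to be a regular Laguerre type matrix of weights. Biorthogonal polynomials: $P_n^{\mathsf L},P_n^{\mathsf R}$ are the monic matrix polynomials of degree $n$ with $\frac1{2\pi i}\int_\gamma P_n^{\mathsf L}(z)W(z)z^k\,dz=\delta_{n,k}C_n^{-1}=\frac1{2\pi i}\int_\gamma z^kW(z)P_n^{\mathsf R}(z)\,dz$ for $k=0,\dots,n$, with $C_n$ nonsingular. Second kind functions: $Q_n^{\mathsf L}(z)=\frac1{2\pi i}\int_\gamma\frac{P_n^{\mathsf L}(z')}{z'-z}W(z')\,dz'$, $Q_n^{\mathsf R}(z)=\frac1{2\pi i}\int_\gamma W(z')\frac{P_n^{\mathsf R}(z')}{z'-z}\,dz'$. Put $$Y^{\mathsf L}_n=\begin{bmatrix}P^{\mathsf L}_n&Q^{\mathsf L}_n\\-C_{n-1}P^{\mathsf L}_{n-1}&-C_{n-1}Q^{\mathsf L}_{n-1}\end{bmatrix},\quad Y^{\mathsf R}_n=\begin{bmatrix}P^{\mathsf R}_n&-P^{\mathsf R}_{n-1}C_{n-1}\\Q^{\mathsf R}_n&-Q^{\mathsf R}_{n-1}C_{n-1}\end{bmatrix}$$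 (both have determinant $1$ on $\mathbb C\setminus\gamma$), with the convention, for $n=0$, $C_{-1}P_{-1}^{\mathsf L}=P_{-1}^{\mathsf R}C_{-1}=0_N$ and $-C_{-1}Q_{-1}^{\mathsf L}=-Q_{-1}^{\mathsf R}C_{-1}=I_N$. Finally $$Z_n^{\mathsf L}=Y^{\mathsf L}_n\begin{bmatrix}W^{\mathsf L}&0_N\\0_N&(W^{\mathsf R})^{-1}\end{bmatrix},\qquad Z^{\mathsf R}_n=\begin{bmatrix}W^{\mathsf R}&0_N\\0_N&(W^{\mathsf L})^{-1}\end{bmatrix}Y^{\mathsf R}_n\qquad\text{on }\mathbb C\setminus\gamma.$$ *)

theory Defs
  imports "HOL-Analysis.Analysis"
begin

section \<open>Matrix-valued functions of a complex variable\<close>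

definition smult_matrix :: "complex \<Rightarrow> complex^'n^'m \<Rightarrow> complex^'n^'m" (infixr \<open>*\<^sub>m\<close> 75)
  where "c *\<^sub>m A = (\<chi> i j. c * A $ i $ j)"

definition block_matrix ::
  "complex^'n^'n \<Rightarrow> complex^'n^'n \<Rightarrow> complex^'n^'n \<Rightarrow> complex^'n^'n \<Rightarrow> complex^('n + 'n)^('n + 'n)"
  where "block_matrix A B C D =
    (\<chi> i j. case (i, j) of
        (Inl a, Inl b) \<Rightarrow> A $ a $ b
      | (Inl a, Inr b) \<Rightarrow> B $ a $ b
      | (Inr a, Inl b) \<Rightarrow> C $ a $ b
      | (Inr a, Inr b) \<Rightarrow> D $ a $ b)"

definition matrix_holomorphic_on :: "(complex \<Rightarrow> complex^'n^'m) \<Rightarrow> complex set \<Rightarrow> bool"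
    (infixl \<open>matrix'_holomorphic'_on\<close> 50)
  where "F matrix_holomorphic_on S \<longleftrightarrow> (\<forall>i j. (\<lambda>z. F z $ i $ j) holomorphic_on S)"

definition matrix_deriv :: "(complex \<Rightarrow> complex^'n^'m) \<Rightarrow> complex \<Rightarrow> complex^'n^'m"
  where "matrix_deriv F z = (\<chi> i j. deriv (\<lambda>w. F w $ i $ j) z)"

text \<open>The class instance of multiplication on the type of matrices is componentwise, so the library
  function \<^const>\<open>exp\<close> cannot be used for matrices.\<close>

definition matrix_exp :: "complex^'n^'n \<Rightarrow> complex^'n^'n"
  where "matrix_exp A = (\<Sum>k. (1 / fact k) *\<^sub>R (((**) A ^^ k) (mat 1)))"

definition spectrum :: "complex^'n^'n \<Rightarrow> complex set"
  where "spectrum A = {\<mu>. \<exists>v. v \<noteq> 0 \<and> A *v v = \<mu> *s v}"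

text \<open>The Leibniz formula for a square matrix whose rows and columns are both indexed by the
  finite set \<open>S\<close>.\<close>

definition det_on :: "'i set \<Rightarrow> ('i \<Rightarrow> 'i \<Rightarrow> complex) \<Rightarrow> complex"
  where "det_on S M = (\<Sum>p | p permutes S. of_int (sign p) * (\<Prod>i\<in>S. M i (p i)))"

lemma det_on_UNIV: "det_on UNIV (\<lambda>i j. A $ i $ j) = det A"
  by (simp add: det_on_def det_def)

definition monic_matrix_poly :: "nat \<Rightarrow> (complex \<Rightarrow> complex^'n^'n) \<Rightarrow> bool"
  where "monic_matrix_poly n P \<longleftrightarrow>
    (\<exists>c. c n = mat 1 \<and> (\<forall>z. P z = (\<Sum>k\<le>n. z ^ k *\<^sub>m c k)))"


section \<open>The curve\<close>

text \<open>The curve is given by a regular parametrization \<open>\<gamma>\<close> on \<open>[0, \<infinity>)\<close>, running from \<open>0\<close> to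
  \<open>\<infinity>\<close>; its point set is \<open>\<gamma> ` {0..}\<close>, which contains \<open>0\<close>. At the end point \<open>0\<close> the derivative is
  one-sided.\<close>

definition laguerre_curve :: "(real \<Rightarrow> complex) \<Rightarrow> bool"
  where "laguerre_curve \<gamma> \<longleftrightarrow>
    \<gamma> 0 = 0 \<and>
    filterlim \<gamma> at_infinity at_top \<and>
    inj_on \<gamma> {0..} \<and>
    (\<exists>D. continuous_on {0..} D \<and>
         (\<forall>t\<ge>0. D t \<noteq> 0 \<and> (\<gamma> has_vector_derivative D t) (at t within {0..}))) \<and>
    (\<forall>R>0. \<exists>!z. z \<in> \<gamma> ` {0..} \<and> norm z = R)"

text \<open>Integrals along the curve are absolutely convergent (Lebesgue) integrals.\<close>

definition curve_integrable :: "(real \<Rightarrow> complex) \<Rightarrow> (complex \<Rightarrow> complex^'n^'m) \<Rightarrow> bool"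
  where "curve_integrable \<gamma> F \<longleftrightarrow>
    (\<forall>i j. set_integrable lborel {0<..}
       (\<lambda>t. F (\<gamma> t) $ i $ j * vector_derivative \<gamma> (at t)))"

definition curve_integral :: "(real \<Rightarrow> complex) \<Rightarrow> (complex \<Rightarrow> complex^'n^'m) \<Rightarrow> complex^'n^'m"
  where "curve_integral \<gamma> F =
    (\<chi> i j. LINT t:{0<..}|lborel. F (\<gamma> t) $ i $ j * vector_derivative \<gamma> (at t))"

text \<open>The points \<open>\<gamma> s + \<i> * \<epsilon> * \<gamma>' s\<close> with \<open>s\<close> near \<open>t\<close> and small \<open>\<epsilon> > 0\<close> are exactly the points
  near \<open>\<gamma> t\<close> on the left of the curve (each is displaced along a left normal), so the following is
  the unrestricted, not only the normal, boundary value from the left at \<open>\<gamma> t\<close>.\<close>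

definition has_left_value ::
  "(real \<Rightarrow> complex) \<Rightarrow> (complex \<Rightarrow> 'b::topological_space) \<Rightarrow> real \<Rightarrow> 'b \<Rightarrow> bool"
  where "has_left_value \<gamma> f t v \<longleftrightarrow>
    ((\<lambda>(s, \<epsilon>). f (\<gamma> s + \<i> * complex_of_real \<epsilon> * vector_derivative \<gamma> (at s))) \<longlongrightarrow> v)
      (nhds t \<times>\<^sub>F at_right (0::real))"

definition log_branch :: "(real \<Rightarrow> complex) \<Rightarrow> (complex \<Rightarrow> complex) \<Rightarrow> bool"
  where "log_branch \<gamma> lg \<longleftrightarrow>
    lg holomorphic_on - \<gamma> ` {0..} \<and> (\<forall>z. z \<notin> \<gamma> ` {0..} \<longrightarrow> exp (lg z) = z)"


section \<open>Laguerre type matrices of weights\<close>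

definition holder_continuous_on :: "complex set \<Rightarrow> (complex \<Rightarrow> complex) \<Rightarrow> bool"
  where "holder_continuous_on S f \<longleftrightarrow>
    (\<exists>C \<nu>. 0 < \<nu> \<and> \<nu> \<le> 1 \<and>
       (\<forall>x\<in>S. \<forall>y\<in>S. norm (f x - f y) \<le> C * norm (x - y) powr \<nu>))"

definition moment :: "(real \<Rightarrow> complex) \<Rightarrow> (complex \<Rightarrow> complex^'n^'n) \<Rightarrow> nat \<Rightarrow> complex^'n^'n"
  where "moment \<gamma> W n = (1 / (2 * pi * \<i>)) *\<^sub>m curve_integral \<gamma> (\<lambda>z. z ^ n *\<^sub>m W z)"

text \<open>On the curve, the powers and logarithms in the entries are those formed with the boundary
  value \<open>l\<close> of the branch \<open>lg\<close> from the left. The function \<open>h m\<close> stands for its own entire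
  extension. The weight is evaluated at \<open>\<gamma> t\<close> with \<open>t > 0\<close> only, since the logarithm has no value at
  the end point \<open>0\<close>.\<close>

definition laguerre_weight ::
  "(real \<Rightarrow> complex) \<Rightarrow> (complex \<Rightarrow> complex) \<Rightarrow> (complex \<Rightarrow> complex^'n^'n) \<Rightarrow> bool"
  where "laguerre_weight \<gamma> lg W \<longleftrightarrow>
    (\<forall>n. curve_integrable \<gamma> (\<lambda>z. z ^ n *\<^sub>m W z)) \<and>
    (\<forall>j k. \<exists>(I::nat set) (h::nat \<Rightarrow> complex \<Rightarrow> complex) (\<alpha>::nat \<Rightarrow> real) (p::nat \<Rightarrow> nat).
       finite I \<and>
       (\<forall>m\<in>I. \<alpha> m > -1 \<and>
          h m holomorphic_on UNIV \<and>
          holder_continuous_on (\<gamma> ` {0..}) (h m) \<and>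
          bounded (h m ` \<gamma> ` {0..}) \<and>
          (\<forall>z\<in>\<gamma> ` {0..}. h m z \<noteq> 0)) \<and>
       (\<forall>t>0. \<exists>l. has_left_value \<gamma> lg t l \<and>
          W (\<gamma> t) $ j $ k =
            (\<Sum>m\<in>I. h m (\<gamma> t) * exp (complex_of_real (\<alpha> m) * l) * l ^ p m)))"

text \<open>The row index \<open>(j, a)\<close> is row \<open>a\<close> of the \<open>j\<close>-th block row of the block Hankel matrix of
  moments, and likewise for columns.\<close>

definition regular_weight :: "(real \<Rightarrow> complex) \<Rightarrow> (complex \<Rightarrow> complex^'n^'n) \<Rightarrow> bool"
  where "regular_weight \<gamma> W \<longleftrightarrow>
    (\<forall>n. det_on ({0..n} \<times> (UNIV :: 'n set))
           (\<lambda>(j, a) (k, b). moment \<gamma> W (j + k) $ a $ b) \<noteq> 0)"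


section \<open>Biorthogonal polynomials and second kind functions\<close>

definition biorthogonal ::
  "(real \<Rightarrow> complex) \<Rightarrow> (complex \<Rightarrow> complex^'n^'n) \<Rightarrow> (nat \<Rightarrow> complex \<Rightarrow> complex^'n^'n) \<Rightarrow>
   (nat \<Rightarrow> complex \<Rightarrow> complex^'n^'n) \<Rightarrow> (nat \<Rightarrow> complex^'n^'n) \<Rightarrow> bool"
  where "biorthogonal \<gamma> W PL PR C \<longleftrightarrow>
    (\<forall>n. monic_matrix_poly n (PL n) \<and> monic_matrix_poly n (PR n) \<and> invertible (C n) \<and>
      (\<forall>k\<le>n.
        (1 / (2 * pi * \<i>)) *\<^sub>m curve_integral \<gamma> (\<lambda>z. z ^ k *\<^sub>m (PL n z ** W z))
          = (if k = n then matrix_inv (C n) else 0) \<and>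
        (1 / (2 * pi * \<i>)) *\<^sub>m curve_integral \<gamma> (\<lambda>z. z ^ k *\<^sub>m (W z ** PR n z))
          = (if k = n then matrix_inv (C n) else 0)))"

definition second_kind_L ::
  "(real \<Rightarrow> complex) \<Rightarrow> (complex \<Rightarrow> complex^'n^'n) \<Rightarrow> (complex \<Rightarrow> complex^'n^'n) \<Rightarrow>
   complex \<Rightarrow> complex^'n^'n"
  where "second_kind_L \<gamma> W P z =
    (1 / (2 * pi * \<i>)) *\<^sub>m curve_integral \<gamma> (\<lambda>w. (1 / (w - z)) *\<^sub>m (P w ** W w))"

definition second_kind_R ::
  "(real \<Rightarrow> complex) \<Rightarrow> (complex \<Rightarrow> complex^'n^'n) \<Rightarrow> (complex \<Rightarrow> complex^'n^'n) \<Rightarrow>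
   complex \<Rightarrow> complex^'n^'n"
  where "second_kind_R \<gamma> W P z =
    (1 / (2 * pi * \<i>)) *\<^sub>m curve_integral \<gamma> (\<lambda>w. (1 / (w - z)) *\<^sub>m (W w ** P w))"

fun Y_L ::
  "(real \<Rightarrow> complex) \<Rightarrow> (complex \<Rightarrow> complex^'n^'n) \<Rightarrow> (nat \<Rightarrow> complex \<Rightarrow> complex^'n^'n) \<Rightarrow>
   (nat \<Rightarrow> complex^'n^'n) \<Rightarrow> nat \<Rightarrow> complex \<Rightarrow> complex^('n + 'n)^('n + 'n)"
  where
  "Y_L \<gamma> W P C 0 z = block_matrix (P 0 z) (second_kind_L \<gamma> W (P 0) z) 0 (mat 1)"
| "Y_L \<gamma> W P C (Suc n) z =
     block_matrix (P (Suc n) z) (second_kind_L \<gamma> W (P (Suc n)) z)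
       (- (C n ** P n z)) (- (C n ** second_kind_L \<gamma> W (P n) z))"

fun Y_R ::
  "(real \<Rightarrow> complex) \<Rightarrow> (complex \<Rightarrow> complex^'n^'n) \<Rightarrow> (nat \<Rightarrow> complex \<Rightarrow> complex^'n^'n) \<Rightarrow>
   (nat \<Rightarrow> complex^'n^'n) \<Rightarrow> nat \<Rightarrow> complex \<Rightarrow> complex^('n + 'n)^('n + 'n)"
  where
  "Y_R \<gamma> W P C 0 z = block_matrix (P 0 z) 0 (second_kind_R \<gamma> W (P 0) z) (mat 1)"
| "Y_R \<gamma> W P C (Suc n) z =
     block_matrix (P (Suc n) z) (- (P n z ** C n))
       (second_kind_R \<gamma> W (P (Suc n)) z) (- (second_kind_R \<gamma> W (P n) z ** C n))"


section \<open>Structure matrices\<close>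

text \<open>In the next two definitions \<open>Y\<close> is to be instantiated by \<open>Y_L \<gamma> W P C n\<close> and
  \<open>Y_R \<gamma> W P C n\<close> respectively.\<close>

definition Z_L ::
  "(complex \<Rightarrow> complex^'n^'n) \<Rightarrow> (complex \<Rightarrow> complex^'n^'n) \<Rightarrow>
   (complex \<Rightarrow> complex^('n + 'n)^('n + 'n)) \<Rightarrow> complex \<Rightarrow> complex^('n + 'n)^('n + 'n)"
  where "Z_L WL WR Y z = Y z ** block_matrix (WL z) 0 0 (matrix_inv (WR z))"

definition Z_R ::
  "(complex \<Rightarrow> complex^'n^'n) \<Rightarrow> (complex \<Rightarrow> complex^'n^'n) \<Rightarrow>
   (complex \<Rightarrow> complex^('n + 'n)^('n + 'n)) \<Rightarrow> complex \<Rightarrow> complex^('n + 'n)^('n + 'n)"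
  where "Z_R WL WR Y z = block_matrix (WR z) 0 0 (matrix_inv (WL z)) ** Y z"

definition structure_matrix_L ::
  "(complex \<Rightarrow> complex^'m^'m) \<Rightarrow> complex \<Rightarrow> complex^'m^'m"
  where "structure_matrix_L Z z = matrix_deriv Z z ** matrix_inv (Z z)"

definition structure_matrix_R ::
  "(complex \<Rightarrow> complex^'m^'m) \<Rightarrow> complex \<Rightarrow> complex^'m^'m"
  where "structure_matrix_R Z z = matrix_inv (Z z) ** matrix_deriv Z z"


section \<open>The Pearson setting\<close>

definition pearson_L ::
  "(real \<Rightarrow> complex) \<Rightarrow> (complex \<Rightarrow> complex) \<Rightarrow>
   (complex \<Rightarrow> complex^'n^'n) \<Rightarrow> (complex \<Rightarrow> complex^'n^'n) \<Rightarrow> bool"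
  where "pearson_L \<gamma> lg h WL \<longleftrightarrow>
    h matrix_holomorphic_on UNIV \<and>
    WL matrix_holomorphic_on - \<gamma> ` {0..} \<and>
    (\<forall>z. z \<notin> \<gamma> ` {0..} \<longrightarrow>
       invertible (WL z) \<and> z *\<^sub>m matrix_deriv WL z = h z ** WL z) \<and>
    (\<exists>(H :: complex \<Rightarrow> complex^'n^'n) (A :: complex^'n^'n) (W0 :: complex^'n^'n).
       H matrix_holomorphic_on UNIV \<and> (\<forall>z. z \<noteq> 0 \<longrightarrow> invertible (H z)) \<and>
       spectrum A \<subseteq> complex_of_real ` {-1<..} \<and>
       invertible W0 \<and>
       (\<forall>z. z \<notin> \<gamma> ` {0..} \<longrightarrow> WL z = H z ** matrix_exp (lg z *\<^sub>m A) ** W0))"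

definition pearson_R ::
  "(real \<Rightarrow> complex) \<Rightarrow> (complex \<Rightarrow> complex) \<Rightarrow>
   (complex \<Rightarrow> complex^'n^'n) \<Rightarrow> (complex \<Rightarrow> complex^'n^'n) \<Rightarrow> bool"
  where "pearson_R \<gamma> lg h WR \<longleftrightarrow>
    h matrix_holomorphic_on UNIV \<and>
    WR matrix_holomorphic_on - \<gamma> ` {0..} \<and>
    (\<forall>z. z \<notin> \<gamma> ` {0..} \<longrightarrow>
       invertible (WR z) \<and> z *\<^sub>m matrix_deriv WR z = WR z ** h z) \<and>
    (\<exists>(H :: complex \<Rightarrow> complex^'n^'n) (A :: complex^'n^'n) (W0 :: complex^'n^'n).
       H matrix_holomorphic_on UNIV \<and> (\<forall>z. z \<noteq> 0 \<longrightarrow> invertible (H z)) \<and>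
       spectrum A \<subseteq> complex_of_real ` {-1<..} \<and>
       invertible W0 \<and>
       (\<forall>z. z \<notin> \<gamma> ` {0..} \<longrightarrow> WR z = W0 ** matrix_exp (lg z *\<^sub>m A) ** H z))"

end

(* Off the curve the two identities are the product rule applied to Z = Y D and Z = D Y, with D block
   diagonal and z D' read off from the Pearson equations, once Y is known to be holomorphic and
   invertible.  Holomorphy comes from differentiating Cauchy transforms under the integral.
   Invertibility needs no jump relation or Liouville argument: the inverse of Y_L is made of the
   blocks of Y_R, because P_n^L Q_m^R - Q_n^L P_m^R (for |n - m| <= 1) is an integral of divided
   differences of P_n^L and P_m^R against the weight, which biorthogonality evaluates. *)

theory Submission
  imports Defs
begin

text \<open>\<open>deriv\<close>, \<open>matrix_inv\<close> and \<open>curve_integral\<close> are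
  total functions: without differentiability, invertibility or convergence they return default
  values that obey no rule of calculus. This is what shapes the proof. The product rule for
  \<open>Z\<close> needs \<open>Y\<close> to be holomorphic, cancelling \<open>Z\<close> against its
  inverse needs \<open>Y\<close> to be invertible, and every integral needs absolute convergence,
  which is traced back to the moments of the weight. The blocks do not commute, so no 2 by 2
  determinant formula is available. The matrix rearranged from \<open>Y_R\<close> is checked to be a
  right inverse of \<open>Y_L\<close>; since a right inverse of a square complex matrix is also a
  left inverse, the same identity read with its factors exchanged shows that \<open>Y_R\<close> is
  invertible.\<close>

section \<open>Matrix algebra\<close>

lemma smult_matrix_nth [simp]: "(c *\<^sub>m A) $ i $ j = c * A $ i $ j"
  by (simp add: smult_matrix_def)

lemma matrix_mult_nth: "(A ** B) $ i $ j = (\<Sum>k\<in>UNIV. A $ i $ k * B $ k $ j)"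
  by (simp add: matrix_matrix_mult_def)

lemma smult_matrix_mult_left: "(c *\<^sub>m A) ** B = c *\<^sub>m (A ** B)"
  by (simp add: vec_eq_iff matrix_mult_nth sum_distrib_left mult.assoc)

lemma smult_matrix_mult_right: "A ** (c *\<^sub>m B) = c *\<^sub>m (A ** B)"
  by (simp add: vec_eq_iff matrix_mult_nth sum_distrib_left mult.left_commute)

lemma smult_matrix_add: "c *\<^sub>m (A + B) = c *\<^sub>m A + c *\<^sub>m B"
  by (simp add: vec_eq_iff distrib_left)

lemma smult_matrix_diff: "c *\<^sub>m (A - B) = c *\<^sub>m A - c *\<^sub>m B"
  by (simp add: vec_eq_iff right_diff_distrib)

lemma smult_matrix_minus: "c *\<^sub>m (- A) = - (c *\<^sub>m A)"
  by (simp add: vec_eq_iff)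

lemma smult_matrix_zero [simp]: "c *\<^sub>m 0 = 0"
  by (simp add: vec_eq_iff)

lemma smult_matrix_smult: "c *\<^sub>m d *\<^sub>m A = (c * d) *\<^sub>m A"
  by (simp add: vec_eq_iff mult.assoc)

lemma smult_matrix_one [simp]: "1 *\<^sub>m A = A"
  by (simp add: vec_eq_iff)

lemma smult_matrix_sum: "c *\<^sub>m (\<Sum>k\<in>K. A k) = (\<Sum>k\<in>K. c *\<^sub>m A k)"
  by (simp add: vec_eq_iff sum_distrib_left)

lemma matrix_add_rdistrib: "(A + B) ** C = A ** C + B ** (C :: complex^'n^'m)"
  by (simp add: vec_eq_iff matrix_mult_nth distrib_right sum.distrib)

lemma matrix_diff_ldistrib: "A ** (B - C) = A ** B - A ** (C :: complex^'n^'m)"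
  by (simp add: vec_eq_iff matrix_mult_nth right_diff_distrib sum_subtractf)

lemma matrix_diff_rdistrib: "(A - B) ** C = A ** C - B ** (C :: complex^'n^'m)"
  by (simp add: vec_eq_iff matrix_mult_nth left_diff_distrib sum_subtractf)

lemma matrix_mult_minus_left: "(- A) ** B = - (A ** (B :: complex^'n^'m))"
  by (simp add: vec_eq_iff matrix_mult_nth sum_negf)

lemma matrix_mult_minus_right: "A ** (- B) = - (A ** (B :: complex^'n^'m))"
  by (simp add: vec_eq_iff matrix_mult_nth sum_negf)

lemma matrix_mult_sum_left: "(\<Sum>k\<in>K. A k) ** B = (\<Sum>k\<in>K. A k ** (B :: complex^'n^'m))"
  by (induction K rule: infinite_finite_induct) (simp_all add: matrix_add_rdistrib)

lemma matrix_mult_sum_right: "A ** (\<Sum>k\<in>K. B k) = (\<Sum>k\<in>K. A ** (B k :: complex^'n^'m))"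
  by (induction K rule: infinite_finite_induct) (simp_all add: matrix_add_ldistrib)

lemma block_matrix_nth [simp]:
  "block_matrix A B C D $ Inl a $ Inl b = A $ a $ b"
  "block_matrix A B C D $ Inl a $ Inr b' = B $ a $ b'"
  "block_matrix A B C D $ Inr a' $ Inl b = C $ a' $ b"
  "block_matrix A B C D $ Inr a' $ Inr b' = D $ a' $ b'"
  by (simp_all add: block_matrix_def)

lemma block_matrix_eqI:
  fixes X Y :: "complex^('n::finite + 'n)^('n + 'n)"
  assumes "\<And>a b. X $ Inl a $ Inl b = Y $ Inl a $ Inl b" "\<And>a b. X $ Inl a $ Inr b = Y $ Inl a $ Inr b"
    "\<And>a b. X $ Inr a $ Inl b = Y $ Inr a $ Inl b" "\<And>a b. X $ Inr a $ Inr b = Y $ Inr a $ Inr b"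
  shows "X = Y"
proof -
  have "X $ i $ j = Y $ i $ j" for i j
    using assms by (cases i; cases j) auto
  then show ?thesis
    by (simp add: vec_eq_iff)
qed

lemma sum_UNIV_Plus:
  fixes f :: "'a::finite + 'b::finite \<Rightarrow> complex"
  shows "(\<Sum>x\<in>UNIV. f x) = (\<Sum>a\<in>UNIV. f (Inl a)) + (\<Sum>b\<in>UNIV. f (Inr b))"
  unfolding UNIV_Plus_UNIV[symmetric] by (subst sum.Plus) auto

lemma block_matrix_mult:
  "block_matrix A B C D ** block_matrix A' B' C' D' =
   block_matrix (A ** A' + B ** C') (A ** B' + B ** D') (C ** A' + D ** C') (C ** B' + D ** D')"
  by (rule block_matrix_eqI) (simp_all add: matrix_mult_nth sum_UNIV_Plus)

lemma smult_block_matrix: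
  "c *\<^sub>m block_matrix A B C D = block_matrix (c *\<^sub>m A) (c *\<^sub>m B) (c *\<^sub>m C) (c *\<^sub>m D)"
  by (rule block_matrix_eqI) simp_all

lemma block_matrix_one: "block_matrix (mat 1) 0 0 (mat 1) = mat 1"
  by (rule block_matrix_eqI) (simp_all add: mat_def)

section \<open>Calculus of matrix functions\<close>

lemma matrix_holomorphic_on_nth:
  "F matrix_holomorphic_on S \<Longrightarrow> (\<lambda>z. F z $ i $ j) holomorphic_on S"
  by (simp add: matrix_holomorphic_on_def)

lemma matrix_holomorphic_on_mult:
  assumes "F matrix_holomorphic_on S" "G matrix_holomorphic_on S"
  shows "(\<lambda>z. F z ** G z) matrix_holomorphic_on S"
  using assms by (auto simp: matrix_holomorphic_on_def matrix_mult_nth intro!: holomorphic_intros)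

lemma matrix_holomorphic_on_const: "(\<lambda>z. A) matrix_holomorphic_on S"
  by (simp add: matrix_holomorphic_on_def)

lemma matrix_holomorphic_on_minus:
  "F matrix_holomorphic_on S \<Longrightarrow> (\<lambda>z. - F z) matrix_holomorphic_on S"
  by (auto simp: matrix_holomorphic_on_def intro!: holomorphic_intros)

lemma matrix_holomorphic_on_block:
  assumes "A matrix_holomorphic_on S" "B matrix_holomorphic_on S"
    "C matrix_holomorphic_on S" "D matrix_holomorphic_on S"
  shows "(\<lambda>z. block_matrix (A z) (B z) (C z) (D z)) matrix_holomorphic_on S"
  unfolding matrix_holomorphic_on_def
proof (intro allI)
  fix i j
  show "(\<lambda>z. block_matrix (A z) (B z) (C z) (D z) $ i $ j) holomorphic_on S"
    using assms by (cases i; cases j) (simp_all add: matrix_holomorphic_on_nth)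
qed

section \<open>Determinants and inverses of holomorphic matrix functions\<close>

lemma det_holomorphic_on:
  assumes "F matrix_holomorphic_on S"
  shows "(\<lambda>z. det (F z)) holomorphic_on S"
  unfolding det_def
  by (intro holomorphic_intros matrix_holomorphic_on_nth assms)

lemma matrix_inv_cancel:
  assumes "invertible A"
  shows "A ** matrix_inv A = mat 1" "matrix_inv A ** A = mat 1"
  using someI_ex[OF assms[unfolded invertible_def]] by (simp_all add: matrix_inv_def)

text \<open>Column \<open>j\<close> of the inverse solves A x = e_j, so Cramer's rule applies. The
  formula displays each entry as a quotient of determinants, from which holomorphy of the inverse
  can be read off.\<close>

lemma matrix_inv_nth:
  fixes A :: "complex^'n^'n"
  assumes "invertible A"
  shows "matrix_inv A $ k $ j = det (\<chi> i l. if l = k then mat 1 $ i $ j else A $ i $ l) / det A"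
proof -
  have "det A \<noteq> 0"
    using assms by (simp add: invertible_det_nz)
  moreover have "A *v column j (matrix_inv A) = column j (mat 1)"
    by (simp add: matrix_inv_cancel(1)[OF assms, symmetric] vec_eq_iff column_def matrix_mult_nth
        matrix_vector_mult_def)
  ultimately have "column j (matrix_inv A) =
      (\<chi> k. det (\<chi> i l. if l = k then column j (mat 1) $ i else A $ i $ l) / det A)"
    using cramer by blast
  then have "column j (matrix_inv A) $ k =
      det (\<chi> i l. if l = k then column j (mat 1) $ i else A $ i $ l) / det A"
    by (metis (no_types, lifting) vec_lambda_beta)
  then show ?thesis
    by (simp add: column_def cong: if_cong)
qed

lemma matrix_holomorphic_on_inv:
  fixes F :: "complex \<Rightarrow> complex^'n^'n"
  assumes F: "F matrix_holomorphic_on S" and inv: "\<And>z. z \<in> S \<Longrightarrow> invertible (F z)"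
  shows "(\<lambda>z. matrix_inv (F z)) matrix_holomorphic_on S"
  unfolding matrix_holomorphic_on_def
proof (intro allI)
  fix k j
  have "(\<lambda>z. (\<chi> i l. if l = k then mat 1 $ i $ j else F z $ i $ l) :: complex^'n^'n) matrix_holomorphic_on S"
    unfolding matrix_holomorphic_on_def
  proof (intro allI)
    fix i l
    show "(\<lambda>z. (\<chi> i l. if l = k then mat 1 $ i $ j else F z $ i $ l) $ i $ l) holomorphic_on S"
      using F by (cases "l = k") (simp_all add: matrix_holomorphic_on_nth)
  qed
  then have "(\<lambda>z. det (\<chi> i l. if l = k then mat 1 $ i $ j else F z $ i $ l) / det (F z))
      holomorphic_on S"
    using inv by (intro holomorphic_on_divide det_holomorphic_on F) (auto simp: invertible_det_nz)
  then show "(\<lambda>z. matrix_inv (F z) $ k $ j) holomorphic_on S"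
    by (rule holomorphic_transform) (simp add: matrix_inv_nth inv)
qed

lemma matrix_deriv_mult:
  assumes F: "F matrix_holomorphic_on S" and G: "G matrix_holomorphic_on S"
    and S: "open S" "z \<in> S"
  shows "matrix_deriv (\<lambda>z. F z ** G z) z = matrix_deriv F z ** G z + F z ** matrix_deriv G z"
proof -
  have "((\<lambda>z. \<Sum>k\<in>UNIV. F z $ i $ k * G z $ k $ j) has_field_derivative
      (\<Sum>k\<in>UNIV. F z $ i $ k * deriv (\<lambda>z. G z $ k $ j) z + deriv (\<lambda>z. F z $ i $ k) z * G z $ k $ j))
      (at z)" for i j
    by (intro DERIV_sum DERIV_mult' holomorphic_derivI[OF _ S] matrix_holomorphic_on_nth F G)
  from DERIV_imp_deriv[OF this] show ?thesis
    by (simp add: vec_eq_iff matrix_deriv_def matrix_mult_nth sum.distrib)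
qed

lemma matrix_deriv_cong:
  assumes "open S" "z \<in> S" "\<And>w. w \<in> S \<Longrightarrow> F w = G w"
  shows "matrix_deriv F z = matrix_deriv G z"
proof -
  have "eventually (\<lambda>w. F w = G w) (nhds z)"
    using assms by (metis (mono_tags, lifting) eventually_nhds)
  then have "deriv (\<lambda>w. F w $ i $ j) z = deriv (\<lambda>w. G w $ i $ j) z" for i j
    by (intro deriv_cong_ev) (auto elim: eventually_mono)
  then show ?thesis
    by (simp add: matrix_deriv_def)
qed

lemma matrix_deriv_const [simp]: "matrix_deriv (\<lambda>z. A) z = 0"
  by (simp add: matrix_deriv_def vec_eq_iff)

lemma matrix_deriv_block:
  "matrix_deriv (\<lambda>z. block_matrix (A z) (B z) (C z) (D z)) z =
   block_matrix (matrix_deriv A z) (matrix_deriv B z) (matrix_deriv C z) (matrix_deriv D z)"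
  by (rule block_matrix_eqI) (simp_all add: matrix_deriv_def)

lemma matrix_deriv_inv:
  fixes F :: "complex \<Rightarrow> complex^'n^'n"
  assumes F: "F matrix_holomorphic_on S" and inv: "\<And>z. z \<in> S \<Longrightarrow> invertible (F z)"
    and S: "open S" "z \<in> S"
  shows "matrix_deriv (\<lambda>z. matrix_inv (F z)) z =
    - (matrix_inv (F z) ** matrix_deriv F z ** matrix_inv (F z))"
proof -
  let ?G = "\<lambda>z. matrix_inv (F z)"
  have "matrix_deriv F z ** ?G z + F z ** matrix_deriv ?G z = matrix_deriv (\<lambda>z. F z ** ?G z) z"
    by (rule matrix_deriv_mult[OF F matrix_holomorphic_on_inv[OF F inv] S, symmetric])
  \<comment> \<open>The product is the identity only on \<open>S\<close>; as \<open>S\<close> is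
    open, this is enough to compute the derivative at \<open>z\<close>.\<close>
  also have "\<dots> = matrix_deriv (\<lambda>z. mat 1) z"
    by (rule matrix_deriv_cong[OF S]) (simp add: matrix_inv_cancel inv)
  finally have "F z ** matrix_deriv ?G z = - (matrix_deriv F z ** ?G z)"
    by (simp add: eq_neg_iff_add_eq_0 add.commute)
  then have "?G z ** (F z ** matrix_deriv ?G z) = ?G z ** (- (matrix_deriv F z ** ?G z))"
    by simp
  moreover have "?G z ** (F z ** matrix_deriv ?G z) = matrix_deriv ?G z"
    by (simp add: matrix_mul_assoc matrix_inv_cancel inv S)
  ultimately show ?thesis
    by (simp add: matrix_mult_minus_right matrix_mul_assoc)
qed

section \<open>Cauchy transforms\<close>

text \<open>The bound is demanded only where \<open>f\<close> is nonzero. Later \<open>f\<close>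
  carries the indicator of the positive half line, so nothing has to be known about the kernel at
  parameters t \<le> 0.\<close>

lemma integrable_bounded_mult:
  fixes f u :: "'a \<Rightarrow> complex"
  assumes f: "integrable M f" and u: "u \<in> borel_measurable M"
    and bound: "\<And>t. t \<in> space M \<Longrightarrow> f t \<noteq> 0 \<Longrightarrow> norm (u t) \<le> B"
  shows "integrable M (\<lambda>t. f t * u t)"
proof (rule Bochner_Integration.integrable_bound)
  show "integrable M (\<lambda>t. B * norm (f t))"
    using f by simp
  show "(\<lambda>t. f t * u t) \<in> borel_measurable M"
    using f u by simp
  show "AE t in M. norm (f t * u t) \<le> norm (B * norm (f t))"
  proof (rule AE_I2)
    fix t assume t: "t \<in> space M"
    have "norm (f t) * norm (u t) \<le> norm (f t) * \<bar>B\<bar>"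
    proof (cases "f t = 0")
      case False
      then show ?thesis
        using bound[OF t] by (intro mult_left_mono) auto
    qed simp
    then show "norm (f t * u t) \<le> norm (B * norm (f t))"
      by (simp add: norm_mult abs_mult mult.commute)
  qed
qed

lemma integrable_Cauchy_kernel:
  fixes f c :: "'a \<Rightarrow> complex"
  assumes f: "integrable M f" and c: "c \<in> borel_measurable M" and d: "d > 0"
    and far: "\<And>t. t \<in> space M \<Longrightarrow> f t \<noteq> 0 \<Longrightarrow> d \<le> norm (c t - z)"
  shows "integrable M (\<lambda>t. f t / (c t - z))"
proof -
  have "integrable M (\<lambda>t. f t * (1 / (c t - z)))"
  proof (rule integrable_bounded_mult[OF f, where B = "1 / d"])
    show "norm (1 / (c t - z)) \<le> 1 / d" if "t \<in> space M" "f t \<noteq> 0" for t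
      using far[OF that] d by (simp add: norm_divide frac_le)
  qed (use c in measurable)
  then show ?thesis
    by simp
qed

text \<open>The error of the difference quotient is exactly h times the integral of f / ((c - z)^2
  (c - z - h)). For |h| < d/2 the last factor stays at least d/2 away from zero, so the error is
  O(|h|) and no limit has to be moved inside the integral.\<close>

lemma Cauchy_transform_has_field_derivative:
  fixes f c :: "'a \<Rightarrow> complex"
  assumes f: "integrable M f" and c: "c \<in> borel_measurable M" and d: "d > 0"
    and far: "\<And>t. t \<in> space M \<Longrightarrow> f t \<noteq> 0 \<Longrightarrow> d \<le> norm (c t - z)"
  shows "((\<lambda>w. LINT t|M. f t / (c t - w)) has_field_derivative
    (LINT t|M. f t / (c t - z) / (c t - z))) (at z)"
proof -
  let ?g = "\<lambda>w. LINT t|M. f t / (c t - w)"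
  let ?D = "LINT t|M. f t / (c t - z) / (c t - z)"
  let ?B = "LINT t|M. norm (f t / (c t - z) / (c t - z))"
  have int1: "integrable M (\<lambda>t. f t / (c t - z))"
    by (rule integrable_Cauchy_kernel[OF f c d far])
  \<comment> \<open>\<open>f t / (c t - z)\<close> is integrable and vanishes wherever
    \<open>f\<close> does, so the kernel lemma can be applied to it again.\<close>
  have int2: "integrable M (\<lambda>t. f t / (c t - z) / (c t - z))"
    by (rule integrable_Cauchy_kernel[OF int1 c d far]) auto
  have bound: "norm ((?g (z + h) - ?g z) / h - ?D) \<le> norm h * (2 / d * ?B)"
    if h: "h \<noteq> 0" "norm h < d / 2" for h
  proof -
    have far': "d / 2 \<le> norm (c t - (z + h))" if "t \<in> space M" "f t \<noteq> 0" for t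
      using far[OF that] h norm_triangle_ineq2[of "c t - z" h] by (simp add: algebra_simps)
    have int3: "integrable M (\<lambda>t. f t / (c t - (z + h)))"
      by (rule integrable_Cauchy_kernel[OF f c _ far']) (use d in auto)
    have int4: "integrable M (\<lambda>t. f t / (c t - z) / (c t - z) / (c t - (z + h)))"
      by (rule integrable_Cauchy_kernel[OF int2 c _ far']) (use d in auto)
    have "(?g (z + h) - ?g z) / h - ?D =
        (LINT t|M. (f t / (c t - (z + h)) - f t / (c t - z)) / h - f t / (c t - z) / (c t - z))"
      using int1 int2 int3 by simp
    also have "\<dots> = (LINT t|M. h * (f t / (c t - z) / (c t - z) / (c t - (z + h))))"
    proof (rule Bochner_Integration.integral_cong[OF refl])
      fix t assume t: "t \<in> space M"
      show "(f t / (c t - (z + h)) - f t / (c t - z)) / h - f t / (c t - z) / (c t - z) =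
          h * (f t / (c t - z) / (c t - z) / (c t - (z + h)))"
      proof (cases "f t = 0")
        case False
        define u v where "u = c t - z" and "v = c t - (z + h)"
        have uv: "u \<noteq> 0" "v \<noteq> 0" "h = u - v"
          using far[OF t False] far'[OF t False] d by (auto simp: u_def v_def)
        have "f t / v - f t / u = h * (f t / (u * v))"
          unfolding uv(3) using uv(1,2) by (simp add: field_simps)
        moreover have "f t / (u * v) - f t / u / u = h * (f t / u / u / v)"
          unfolding uv(3) using uv(1,2) by (simp add: field_simps)
        ultimately show ?thesis
          using h unfolding u_def[symmetric] v_def[symmetric] by simp
      qed simp
    qed
    also have "norm \<dots> \<le> (LINT t|M. norm (h * (f t / (c t - z) / (c t - z) / (c t - (z + h)))))"
      by (rule integral_norm_bound)
    also have "\<dots> \<le> (LINT t|M. norm h * (2 / d * norm (f t / (c t - z) / (c t - z))))"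
    proof (rule integral_mono)
      fix t assume t: "t \<in> space M"
      have "norm (f t / (c t - z) / (c t - z) / (c t - (z + h))) \<le>
          2 / d * norm (f t / (c t - z) / (c t - z))"
      proof (cases "f t = 0")
        case False
        have "norm (f t / (c t - z) / (c t - z)) / norm (c t - (z + h)) \<le>
            norm (f t / (c t - z) / (c t - z)) / (d / 2)"
          using far'[OF t False] d by (intro divide_left_mono) (auto intro!: mult_pos_pos)
        then show ?thesis
          by (simp add: norm_divide norm_mult mult_ac)
      qed simp
      then show "norm (h * (f t / (c t - z) / (c t - z) / (c t - (z + h)))) \<le>
          norm h * (2 / d * norm (f t / (c t - z) / (c t - z)))"
        by (simp only: norm_mult) (intro mult_left_mono; simp)
    qed (intro integrable_norm integrable_mult_right int2 int4)+
    also have "\<dots> = norm h * (2 / d * ?B)"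
      by simp
    finally show ?thesis .
  qed
  have "((\<lambda>h. (?g (z + h) - ?g z) / h - ?D) \<longlongrightarrow> 0) (at 0)"
  proof (rule Lim_null_comparison)
    show "\<forall>\<^sub>F h in at 0. norm ((?g (z + h) - ?g z) / h - ?D) \<le> norm h * (2 / d * ?B)"
      unfolding eventually_at using bound d by (intro exI[of _ "d / 2"]) auto
    show "((\<lambda>h. norm h * (2 / d * ?B)) \<longlongrightarrow> 0) (at (0::complex))"
      by (rule tendsto_eq_intros | simp)+
  qed
  then show ?thesis
    unfolding DERIV_def by (subst LIM_zero_iff[symmetric])
qed


section \<open>Integrals along the curve\<close>

text \<open>Convergence and value are bundled, on the pattern of
  \<open>has_bochner_integral\<close>, so that each linearity rule transports both at once.\<close>

definition has_curve_integral ::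
  "(real \<Rightarrow> complex) \<Rightarrow> (complex \<Rightarrow> complex^'n^'m) \<Rightarrow> complex^'n^'m \<Rightarrow> bool"
  where "has_curve_integral \<gamma> F v \<longleftrightarrow>
    (\<forall>i j. has_bochner_integral lborel
      (\<lambda>t. indicator {0<..} t *\<^sub>R (F (\<gamma> t) $ i $ j * vector_derivative \<gamma> (at t))) (v $ i $ j))"

lemma has_curve_integral_iff:
  "has_curve_integral \<gamma> F v \<longleftrightarrow> curve_integrable \<gamma> F \<and> curve_integral \<gamma> F = v"
  by (auto simp: has_curve_integral_def curve_integrable_def curve_integral_def vec_eq_iff
      has_bochner_integral_iff set_integrable_def set_lebesgue_integral_def)

lemma has_curve_integral_cong:
  assumes "\<And>t. t > 0 \<Longrightarrow> F (\<gamma> t) = G (\<gamma> t)"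
  shows "has_curve_integral \<gamma> F v \<longleftrightarrow> has_curve_integral \<gamma> G v"
  unfolding has_curve_integral_def
  by (intro all_cong1 has_bochner_integral_cong) (auto simp: indicator_def assms)

lemma has_curve_integral_diff:
  assumes "has_curve_integral \<gamma> F u" "has_curve_integral \<gamma> G v"
  shows "has_curve_integral \<gamma> (\<lambda>w. F w - G w) (u - v)"
  unfolding has_curve_integral_def
proof (intro allI)
  fix i j
  show "has_bochner_integral lborel
      (\<lambda>t. indicator {0<..} t *\<^sub>R ((F (\<gamma> t) - G (\<gamma> t)) $ i $ j * vector_derivative \<gamma> (at t)))
      ((u - v) $ i $ j)"
    using has_bochner_integral_diff[OF assms[unfolded has_curve_integral_def, rule_format, of i j]]
    by (simp add: algebra_simps)
qed

lemma has_curve_integral_sum: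
  assumes "\<And>k. k \<in> K \<Longrightarrow> has_curve_integral \<gamma> (F k) (v k)"
  shows "has_curve_integral \<gamma> (\<lambda>w. \<Sum>k\<in>K. F k w) (\<Sum>k\<in>K. v k)"
  unfolding has_curve_integral_def
proof (intro allI)
  fix i j
  have "has_bochner_integral lborel
      (\<lambda>t. \<Sum>k\<in>K. indicator {0<..} t *\<^sub>R (F k (\<gamma> t) $ i $ j * vector_derivative \<gamma> (at t)))
      (\<Sum>k\<in>K. v k $ i $ j)"
    using assms by (intro has_bochner_integral_sum) (simp add: has_curve_integral_def)
  then show "has_bochner_integral lborel
      (\<lambda>t. indicator {0<..} t *\<^sub>R ((\<Sum>k\<in>K. F k (\<gamma> t)) $ i $ j * vector_derivative \<gamma> (at t)))
      ((\<Sum>k\<in>K. v k) $ i $ j)"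
    by (simp add: sum_distrib_right scaleR_sum_right)
qed

lemma has_curve_integral_mult_left:
  assumes "has_curve_integral \<gamma> F v"
  shows "has_curve_integral \<gamma> (\<lambda>w. A ** F w) (A ** v)"
  unfolding has_curve_integral_def
proof (intro allI)
  fix i j
  have "has_bochner_integral lborel
      (\<lambda>t. \<Sum>k\<in>UNIV. A $ i $ k * (indicator {0<..} t *\<^sub>R (F (\<gamma> t) $ k $ j * vector_derivative \<gamma> (at t))))
      (\<Sum>k\<in>UNIV. A $ i $ k * v $ k $ j)"
    using assms
    by (intro has_bochner_integral_sum has_bochner_integral_mult_right) (simp add: has_curve_integral_def)
  then show "has_bochner_integral lborel
      (\<lambda>t. indicator {0<..} t *\<^sub>R ((A ** F (\<gamma> t)) $ i $ j * vector_derivative \<gamma> (at t)))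
      ((A ** v) $ i $ j)"
    by (simp add: matrix_mult_nth sum_distrib_right scaleR_sum_right mult.assoc)
qed

lemma has_curve_integral_mult_right:
  assumes "has_curve_integral \<gamma> F v"
  shows "has_curve_integral \<gamma> (\<lambda>w. F w ** A) (v ** A)"
  unfolding has_curve_integral_def
proof (intro allI)
  fix i j
  have "has_bochner_integral lborel
      (\<lambda>t. \<Sum>k\<in>UNIV. indicator {0<..} t *\<^sub>R (F (\<gamma> t) $ i $ k * vector_derivative \<gamma> (at t)) * A $ k $ j)
      (\<Sum>k\<in>UNIV. v $ i $ k * A $ k $ j)"
    using assms
    by (intro has_bochner_integral_sum has_bochner_integral_mult_left) (simp add: has_curve_integral_def)
  also have "(\<lambda>t. \<Sum>k\<in>UNIV. indicator {0<..} t *\<^sub>R (F (\<gamma> t) $ i $ k * vector_derivative \<gamma> (at t)) * A $ k $ j)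
      = (\<lambda>t. indicator {0<..} t *\<^sub>R ((F (\<gamma> t) ** A) $ i $ j * vector_derivative \<gamma> (at t)))"
    by (simp add: fun_eq_iff indicator_def matrix_mult_nth sum_distrib_left mult_ac)
  finally show "has_bochner_integral lborel
      (\<lambda>t. indicator {0<..} t *\<^sub>R ((F (\<gamma> t) ** A) $ i $ j * vector_derivative \<gamma> (at t)))
      ((v ** A) $ i $ j)"
    by (simp add: matrix_mult_nth)
qed

section \<open>Topology of the curve and Cauchy transforms along it\<close>

lemma laguerre_curve_continuous_on:
  assumes "laguerre_curve \<gamma>"
  shows "continuous_on {0..} \<gamma>"
proof -
  obtain D where "\<And>t. t \<ge> 0 \<Longrightarrow> (\<gamma> has_vector_derivative D t) (at t within {0..})"
    using assms unfolding laguerre_curve_def by blast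
  then show ?thesis
    by (auto simp: continuous_on_eq_continuous_within intro: has_vector_derivative_continuous)
qed

text \<open>A convergent sequence of points is bounded, and since \<gamma> tends to infinity its
  parameters stay in some [0, T]; the image of that interval is compact.\<close>

lemma closed_laguerre_curve:
  assumes "laguerre_curve \<gamma>"
  shows "closed (\<gamma> ` {0..})"
  unfolding closed_sequential_limits
proof (intro allI impI, elim conjE)
  fix x l assume x: "\<forall>n. x n \<in> \<gamma> ` {0..}" and lim: "x \<longlonglongrightarrow> l"
  obtain B where B: "\<And>n. norm (x n) \<le> B"
    using convergent_imp_bounded[OF lim] by (auto simp: bounded_iff)
  have "filterlim \<gamma> at_infinity at_top"
    using assms by (simp add: laguerre_curve_def)
  then have "eventually (\<lambda>t. B + 1 \<le> norm (\<gamma> t)) at_top"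
    using filterlim_at_infinity[of 0 \<gamma> at_top] by (metis (no_types, lifting)
      eventually_mono filterlim_at_infinity_conv_norm_at_top filterlim_at_top)
  then obtain T where T: "\<And>t. t \<ge> T \<Longrightarrow> B + 1 \<le> norm (\<gamma> t)"
    by (auto simp: eventually_at_top_linorder)
  have "x n \<in> \<gamma> ` {0..T}" for n
  proof -
    obtain t where "t \<ge> 0" "x n = \<gamma> t"
      using x by auto
    moreover from this have "norm (\<gamma> t) \<le> B"
      using B[of n] by simp
    then have "t \<le> T"
      using T[of t] by (cases "T \<le> t") auto
    ultimately show ?thesis
      by auto
  qed
  moreover have "closed (\<gamma> ` {0..T})"
    by (intro compact_imp_closed compact_continuous_image
        continuous_on_subset[OF laguerre_curve_continuous_on[OF assms]]) auto
  ultimately have "l \<in> \<gamma> ` {0..T}"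
    using closed_sequentially lim by blast
  then show "l \<in> \<gamma> ` {0..}"
    by auto
qed

lemma laguerre_curve_distance:
  assumes "laguerre_curve \<gamma>" "z \<notin> \<gamma> ` {0..}"
  obtains d where "d > 0" "\<And>t. t > 0 \<Longrightarrow> d \<le> norm (\<gamma> t - z)"
proof -
  have "open (- \<gamma> ` {0..})"
    using closed_laguerre_curve[OF assms(1)] by auto
  then obtain d where "d > 0" "ball z d \<subseteq> - \<gamma> ` {0..}"
    using assms(2) by (meson ComplI open_contains_ball)
  moreover from this have "d \<le> norm (\<gamma> t - z)" if "t > 0" for t
    using that by (force simp: subset_iff dist_norm norm_minus_commute not_less[symmetric])
  ultimately show thesis
    using that by blast
qed

lemma curve_integrable_Cauchy_kernel:
  assumes \<gamma>: "laguerre_curve \<gamma>" and F: "curve_integrable \<gamma> F" and z: "z \<notin> \<gamma> ` {0..}"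
  shows "curve_integrable \<gamma> (\<lambda>w. (1 / (w - z)) *\<^sub>m F w)"
    and "\<exists>D. ((\<lambda>z. curve_integral \<gamma> (\<lambda>w. (1 / (w - z)) *\<^sub>m F w) $ i $ j) has_field_derivative D) (at z)"
proof -
  define f where
    "f i j = (\<lambda>t. indicator {0<..} t *\<^sub>R (F (\<gamma> t) $ i $ j * vector_derivative \<gamma> (at t)))" for i j
  \<comment> \<open>The values of \<gamma> at negative parameters are arbitrary. Cutting it off
    makes \<open>c\<close> measurable on the whole line, and the quotient by \<open>c t - z\<close>
    is unaffected because \<open>f\<close> carries the same indicator.\<close>
  define c where "c t = indicator {0<..} t *\<^sub>R \<gamma> t" for t
  obtain d where d: "d > 0" "\<And>t. t > 0 \<Longrightarrow> d \<le> norm (\<gamma> t - z)"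
    using laguerre_curve_distance[OF \<gamma> z] by blast
  have f: "integrable lborel (f i j)" for i j
    using F by (simp add: curve_integrable_def set_integrable_def f_def)
  have "c \<in> borel_measurable borel"
    unfolding c_def using laguerre_curve_continuous_on[OF \<gamma>]
    by (intro borel_measurable_continuous_on_indicator) (auto elim: continuous_on_subset)
  then have c: "c \<in> borel_measurable lborel"
    by simp
  have far: "d \<le> norm (c t - z)" if "f i j t \<noteq> 0" for i j t
    using that d by (auto simp: f_def c_def indicator_def split: if_splits)
  \<comment> \<open>Here \<open>z\<close> is generalised, because the equation is also rewritten
    under the function of \<open>z\<close> that is differentiated.\<close>
  have eq: "indicator {0<..} t *\<^sub>R (((1 / (\<gamma> t - z)) *\<^sub>m F (\<gamma> t)) $ i $ j * vector_derivative \<gamma> (at t)) =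
      f i j t / (c t - z)" for i j t z
    by (simp add: f_def c_def indicator_def)
  show "curve_integrable \<gamma> (\<lambda>w. (1 / (w - z)) *\<^sub>m F w)"
    unfolding curve_integrable_def set_integrable_def eq
    by (intro allI integrable_Cauchy_kernel[OF f c d(1)] far)
  show "\<exists>D. ((\<lambda>z. curve_integral \<gamma> (\<lambda>w. (1 / (w - z)) *\<^sub>m F w) $ i $ j) has_field_derivative D) (at z)"
    unfolding curve_integral_def set_lebesgue_integral_def vec_lambda_beta eq
    by (intro exI, rule Cauchy_transform_has_field_derivative[OF f c d(1)], rule far)
qed

lemma matrix_holomorphic_on_Cauchy:
  assumes "laguerre_curve \<gamma>" "curve_integrable \<gamma> F"
  shows "(\<lambda>z. s *\<^sub>m curve_integral \<gamma> (\<lambda>w. (1 / (w - z)) *\<^sub>m F w)) matrix_holomorphic_on - \<gamma> ` {0..}"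
proof -
  have "(\<lambda>z. curve_integral \<gamma> (\<lambda>w. (1 / (w - z)) *\<^sub>m F w) $ i $ j) holomorphic_on - \<gamma> ` {0..}" for i j
    using curve_integrable_Cauchy_kernel(2)[OF assms] closed_laguerre_curve[OF assms(1)]
    by (subst holomorphic_on_open) auto
  then show ?thesis
    unfolding matrix_holomorphic_on_def smult_matrix_nth by (auto intro!: holomorphic_intros)
qed

section \<open>Biorthogonality\<close>

lemma monic_matrix_poly_holomorphic_on:
  assumes "monic_matrix_poly n P"
  shows "P matrix_holomorphic_on S"
proof -
  obtain c where "\<And>z. P z = (\<Sum>k\<le>n. z ^ k *\<^sub>m c k)"
    using assms unfolding monic_matrix_poly_def by blast
  then show ?thesis
    unfolding matrix_holomorphic_on_def by (auto intro!: holomorphic_intros)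
qed

lemma monic_matrix_poly_0: "monic_matrix_poly 0 P \<Longrightarrow> P z = mat 1"
  by (auto simp: monic_matrix_poly_def)

text \<open>Factor w - z out of each w^i - z^i and collect powers of w. The top coefficient
  \<open>d (n - 1)\<close> is the leading coefficient of \<open>P\<close>, and it is the only one
  whose value matters below. For n = 0 the quotient is zero, hence the guard.\<close>

lemma monic_matrix_poly_divided_difference:
  assumes "monic_matrix_poly n P"
  obtains d where "n > 0 \<Longrightarrow> d (n - 1) = mat 1"
    "\<And>w. P w - P z = (w - z) *\<^sub>m (\<Sum>k<n. w ^ k *\<^sub>m d k)"
proof -
  obtain c where c: "c n = mat 1" "\<And>z. P z = (\<Sum>k\<le>n. z ^ k *\<^sub>m c k)"
    using assms unfolding monic_matrix_poly_def by blast
  define d where "d k = (\<Sum>i=Suc k..n. z ^ (i - k - 1) *\<^sub>m c i)" for k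
  have "d (n - 1) = mat 1" if "n > 0"
    using that c(1) by (simp add: d_def)
  moreover have "P w - P z = (w - z) *\<^sub>m (\<Sum>k<n. w ^ k *\<^sub>m d k)" for w
  proof (cases "n = 0")
    case False
    then have "(\<Sum>i\<le>n. c i $ a $ b * w ^ i) - (\<Sum>i\<le>n. c i $ a $ b * z ^ i) =
        (w - z) * (\<Sum>k<n. (\<Sum>i=Suc k..n. c i $ a $ b * z ^ (i - k - 1)) * w ^ k)" for a b
      by (intro polyfun_diff) simp
    then show ?thesis
      by (simp add: vec_eq_iff c(2) d_def mult.commute)
  qed (simp add: c(2))
  ultimately show thesis
    using that by blast
qed

text \<open>\<open>biorthogonal\<close> prescribes only the values of such integrals; their
  convergence has to come from the moments. The case k = 0 also feeds the Cauchy transforms.\<close>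

lemma curve_integrable_poly_left:
  assumes W: "\<And>n. curve_integrable \<gamma> (\<lambda>z. z ^ n *\<^sub>m W z)" and P: "monic_matrix_poly n P"
  shows "curve_integrable \<gamma> (\<lambda>z. z ^ k *\<^sub>m (P z ** W z))"
proof -
  obtain c where c: "\<And>z. P z = (\<Sum>i\<le>n. z ^ i *\<^sub>m c i)"
    using P unfolding monic_matrix_poly_def by blast
  have "has_curve_integral \<gamma> (\<lambda>z. \<Sum>i\<le>n. c i ** (z ^ (k + i) *\<^sub>m W z))
      (\<Sum>i\<le>n. c i ** curve_integral \<gamma> (\<lambda>z. z ^ (k + i) *\<^sub>m W z))"
    by (intro has_curve_integral_sum has_curve_integral_mult_left) (simp add: has_curve_integral_iff W)
  moreover have "(\<lambda>z. z ^ k *\<^sub>m (P z ** W z)) = (\<lambda>z. \<Sum>i\<le>n. c i ** (z ^ (k + i) *\<^sub>m W z))"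
    by (simp add: c matrix_mult_sum_left smult_matrix_sum smult_matrix_mult_left
        smult_matrix_mult_right smult_matrix_smult power_add)
  ultimately show ?thesis
    by (simp add: has_curve_integral_iff)
qed

lemma curve_integrable_poly_right:
  assumes W: "\<And>n. curve_integrable \<gamma> (\<lambda>z. z ^ n *\<^sub>m W z)" and P: "monic_matrix_poly n P"
  shows "curve_integrable \<gamma> (\<lambda>z. z ^ k *\<^sub>m (W z ** P z))"
proof -
  obtain c where c: "\<And>z. P z = (\<Sum>i\<le>n. z ^ i *\<^sub>m c i)"
    using P unfolding monic_matrix_poly_def by blast
  have "has_curve_integral \<gamma> (\<lambda>z. \<Sum>i\<le>n. (z ^ (k + i) *\<^sub>m W z) ** c i)
      (\<Sum>i\<le>n. curve_integral \<gamma> (\<lambda>z. z ^ (k + i) *\<^sub>m W z) ** c i)"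
    by (intro has_curve_integral_sum has_curve_integral_mult_right) (simp add: has_curve_integral_iff W)
  moreover have "(\<lambda>z. z ^ k *\<^sub>m (W z ** P z)) = (\<lambda>z. \<Sum>i\<le>n. (z ^ (k + i) *\<^sub>m W z) ** c i)"
    by (simp add: c matrix_mult_sum_right smult_matrix_sum smult_matrix_mult_left
        smult_matrix_mult_right smult_matrix_smult power_add)
  ultimately show ?thesis
    by (simp add: has_curve_integral_iff)
qed

text \<open>Adding and subtracting \<open>PL n w ** W w ** PR m w\<close> in the numerator over w -
  z leaves two divided differences, so the Cauchy kernel disappears. That of \<open>PR m\<close> has
  degree m - 1 \<le> n in w, just inside the range where \<open>PL n\<close> is paired with powers
  of w, and symmetrically for \<open>PL n\<close>; this is the purpose of \<open>nm\<close>. Only a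
  leading coefficient can meet a nonzero pairing.\<close>

lemma second_kind_cross_difference:
  fixes W :: "complex \<Rightarrow> complex^'n^'n"
  assumes \<gamma>: "laguerre_curve \<gamma>" and W: "\<And>n. curve_integrable \<gamma> (\<lambda>z. z ^ n *\<^sub>m W z)"
    and bi: "biorthogonal \<gamma> W PL PR C" and z: "z \<notin> \<gamma> ` {0..}"
    and nm: "n \<le> Suc m" "m \<le> Suc n"
  shows "PL n z ** second_kind_R \<gamma> W (PR m) z - second_kind_L \<gamma> W (PL n) z ** PR m z =
    (if m = Suc n then matrix_inv (C n) else 0) - (if n = Suc m then matrix_inv (C m) else 0)"
proof -
  define s :: complex where "s = 2 * pi * \<i>"
  have s: "s \<noteq> 0"
    by (simp add: s_def)
  have monic: "monic_matrix_poly n (PL n)" "monic_matrix_poly m (PR m)"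
    using bi unfolding biorthogonal_def by blast+
  let ?L = "\<lambda>w. PL n w ** W w" and ?R = "\<lambda>w. W w ** PR m w"
  note int_L = curve_integrable_poly_left[OF W monic(1)]
    and int_R = curve_integrable_poly_right[OF W monic(2)]
  have orth: "(1 / s) *\<^sub>m curve_integral \<gamma> (\<lambda>w. w ^ k *\<^sub>m ?L w) =
        (if k = n then matrix_inv (C n) else 0)" if "k \<le> n" for k
    using bi that unfolding biorthogonal_def s_def by blast
  have orth': "(1 / s) *\<^sub>m curve_integral \<gamma> (\<lambda>w. w ^ k *\<^sub>m ?R w) =
        (if k = m then matrix_inv (C m) else 0)" if "k \<le> m" for k
    using bi that unfolding biorthogonal_def s_def by blast
  obtain d where d: "n > 0 \<Longrightarrow> d (n - 1) = mat 1"
      "\<And>w. PL n w - PL n z = (w - z) *\<^sub>m (\<Sum>k<n. w ^ k *\<^sub>m d k)"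
    using monic_matrix_poly_divided_difference[OF monic(1), of z] by blast
  obtain e where e: "m > 0 \<Longrightarrow> e (m - 1) = mat 1"
      "\<And>w. PR m w - PR m z = (w - z) *\<^sub>m (\<Sum>k<m. w ^ k *\<^sub>m e k)"
    using monic_matrix_poly_divided_difference[OF monic(2), of z] by blast
  let ?IL = "\<lambda>k. curve_integral \<gamma> (\<lambda>w. w ^ k *\<^sub>m ?L w)"
    and ?IR = "\<lambda>k. curve_integral \<gamma> (\<lambda>w. w ^ k *\<^sub>m ?R w)"
  have "has_curve_integral \<gamma>
      (\<lambda>w. PL n z ** ((1 / (w - z)) *\<^sub>m ?R w) - ((1 / (w - z)) *\<^sub>m ?L w) ** PR m z)
      (PL n z ** curve_integral \<gamma> (\<lambda>w. (1 / (w - z)) *\<^sub>m ?R w)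
        - curve_integral \<gamma> (\<lambda>w. (1 / (w - z)) *\<^sub>m ?L w) ** PR m z)" (is "has_curve_integral _ ?F ?I")
    using int_L[of 0] int_R[of 0]
    by (intro has_curve_integral_diff has_curve_integral_mult_left has_curve_integral_mult_right)
      (simp_all add: has_curve_integral_iff curve_integrable_Cauchy_kernel[OF \<gamma> _ z])
  moreover have "has_curve_integral \<gamma>
      (\<lambda>w. (\<Sum>k<m. (w ^ k *\<^sub>m ?L w) ** e k) - (\<Sum>k<n. d k ** (w ^ k *\<^sub>m ?R w)))
      ((\<Sum>k<m. ?IL k ** e k) - (\<Sum>k<n. d k ** ?IR k))" (is "has_curve_integral _ ?G ?J")
    by (intro has_curve_integral_diff has_curve_integral_sum has_curve_integral_mult_left
        has_curve_integral_mult_right) (simp_all add: has_curve_integral_iff int_L int_R)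
  moreover have "?F (\<gamma> t) = ?G (\<gamma> t)" if "t > 0" for t
  proof -
    define w where "w = \<gamma> t"
    have wz: "w - z \<noteq> 0"
      using z that by (auto simp: w_def)
    \<comment> \<open>The values at \<open>z\<close> are written through those at \<open>w\<close>
      so that the full product at \<open>w\<close> cancels between the two terms.\<close>
    have L: "PL n z = PL n w - (w - z) *\<^sub>m (\<Sum>k<n. w ^ k *\<^sub>m d k)"
      using d(2)[of w] by (simp add: algebra_simps)
    have R: "PR m z = PR m w - (w - z) *\<^sub>m (\<Sum>k<m. w ^ k *\<^sub>m e k)"
      using e(2)[of w] by (simp add: algebra_simps)
    have "?F w = ?L w ** (\<Sum>k<m. w ^ k *\<^sub>m e k) - (\<Sum>k<n. w ^ k *\<^sub>m d k) ** ?R w"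
      unfolding L R using wz
      by (simp add: matrix_diff_ldistrib matrix_diff_rdistrib smult_matrix_mult_left
          smult_matrix_mult_right smult_matrix_diff smult_matrix_smult matrix_mul_assoc)
    also have "\<dots> = ?G w"
      by (simp add: matrix_mult_sum_left matrix_mult_sum_right smult_matrix_mult_left
          smult_matrix_mult_right)
    finally show ?thesis
      by (simp add: w_def)
  qed
  ultimately have "?I = ?J"
    using has_curve_integral_cong[of ?F \<gamma> ?G] by (metis (no_types, lifting) has_curve_integral_iff)
  have "PL n z ** second_kind_R \<gamma> W (PR m) z - second_kind_L \<gamma> W (PL n) z ** PR m z = (1 / s) *\<^sub>m ?I"
    by (simp add: second_kind_L_def second_kind_R_def s_def smult_matrix_mult_left
        smult_matrix_mult_right smult_matrix_diff)
  also have "\<dots> = (\<Sum>k<m. ((1 / s) *\<^sub>m ?IL k) ** e k) - (\<Sum>k<n. d k ** ((1 / s) *\<^sub>m ?IR k))"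
    unfolding \<open>?I = ?J\<close>
    by (simp add: smult_matrix_diff smult_matrix_sum smult_matrix_mult_left smult_matrix_mult_right)
  \<comment> \<open>From k < m \<le> n + 1 follows k \<le> n, so orthogonality covers every
    term.\<close>
  also have "(\<Sum>k<m. ((1 / s) *\<^sub>m ?IL k) ** e k) =
      (\<Sum>k<m. if k = n then matrix_inv (C n) ** e n else 0)"
    using nm by (intro sum.cong) (auto simp: orth)
  \<comment> \<open>The index k = n is reached only for m = n + 1, and then \<open>e n\<close> is
    the leading coefficient \<open>mat 1\<close>.\<close>
  also have "\<dots> = (if m = Suc n then matrix_inv (C n) else 0)"
    using nm e(1) by auto
  also have "(\<Sum>k<n. d k ** ((1 / s) *\<^sub>m ?IR k)) =
      (\<Sum>k<n. if k = m then d m ** matrix_inv (C m) else 0)"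
    using nm by (intro sum.cong) (auto simp: orth')
  also have "\<dots> = (if n = Suc m then matrix_inv (C m) else 0)"
    using nm d(1) by auto
  finally show ?thesis .
qed

section \<open>Invertibility of \<open>Y_L\<close> and \<open>Y_R\<close>\<close>

lemma block_matrix_eq_one_iff:
  "block_matrix A B C D = mat 1 \<longleftrightarrow> A = mat 1 \<and> B = 0 \<and> C = 0 \<and> D = mat 1"
proof
  assume eq: "block_matrix A B C D = mat 1"
  show "A = mat 1 \<and> B = 0 \<and> C = 0 \<and> D = mat 1"
    unfolding vec_eq_iff block_matrix_nth[of A B C D, symmetric] eq by (simp add: mat_def)
qed (simp add: block_matrix_one)

text \<open>For \<open>2 \<times> 2\<close> matrices over a commutative ring this would be the adjugate; here a two-sided
  inverse built from the blocks of another matrix yields the inverse of that matrix as well.\<close>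

lemma invertible_block_adjugate:
  assumes "block_matrix p q r s ** block_matrix d (- c) (- b) a = mat 1"
  shows "invertible (block_matrix p q r s)" "invertible (block_matrix a b c d)"
proof -
  show "invertible (block_matrix p q r s)"
    using assms invertible_right_inverse by blast
  \<comment> \<open>Exchanging the factors gives relations with the products in the opposite order;
    up to sign these are the entries of the second matrix times its own candidate inverse.\<close>
  have "block_matrix d (- c) (- b) a ** block_matrix p q r s = mat 1"
    using assms matrix_left_right_inverse by blast
  then have "d ** p - c ** r = mat 1" "d ** q - c ** s = 0" "- (b ** p) + a ** r = 0"
      "- (b ** q) + a ** s = mat 1"
    unfolding block_matrix_mult block_matrix_eq_one_iff matrix_mult_minus_left by simp_all
  then have "block_matrix a b c d ** block_matrix s (- r) (- q) p = mat 1"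
    unfolding block_matrix_mult block_matrix_eq_one_iff matrix_mult_minus_right
    by (metis (no_types, lifting) ab_group_add_class.ab_diff_conv_add_uminus add.commute eq_iff_diff_eq_0
        neg_eq_iff_add_eq_0 diff_self)
  then show "invertible (block_matrix a b c d)"
    using invertible_right_inverse by blast
qed

lemma invertible_Y:
  fixes W :: "complex \<Rightarrow> complex^'n^'n"
  assumes \<gamma>: "laguerre_curve \<gamma>" and W: "\<And>n. curve_integrable \<gamma> (\<lambda>z. z ^ n *\<^sub>m W z)"
    and bi: "biorthogonal \<gamma> W PL PR C" and z: "z \<notin> \<gamma> ` {0..}"
  shows "invertible (Y_L \<gamma> W PL C n z)" "invertible (Y_R \<gamma> W PR C n z)"
proof -
  let ?QL = "\<lambda>n. second_kind_L \<gamma> W (PL n) z" and ?QR = "\<lambda>n. second_kind_R \<gamma> W (PR n) z"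
  note cross = second_kind_cross_difference[OF \<gamma> W bi z]
  have "invertible (Y_L \<gamma> W PL C n z) \<and> invertible (Y_R \<gamma> W PR C n z)"
  proof (cases n)
    case 0
    have "PL 0 z = mat 1" "PR 0 z = mat 1"
      using bi monic_matrix_poly_0 unfolding biorthogonal_def by blast+
    \<comment> \<open>The entry \<open>- 0\<close> keeps the shape required by the adjugate rule.
      Since both polynomials are \<open>mat 1\<close>, the cross difference says that the two second
      kind functions agree.\<close>
    then have "block_matrix (PL 0 z) (?QL 0) 0 (mat 1) ** block_matrix (mat 1) (- ?QR 0) (- 0) (PR 0 z) = mat 1"
      using cross[of 0 0] by (simp add: block_matrix_mult block_matrix_eq_one_iff matrix_mult_minus_right)
    from invertible_block_adjugate[OF this] show ?thesis
      by (simp add: 0)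
  next
    case (Suc k)
    have C: "C k ** matrix_inv (C k) = mat 1" "matrix_inv (C k) ** C k = mat 1"
      using bi matrix_inv_cancel unfolding biorthogonal_def by blast+
    \<comment> \<open>In the block product below, the pairings of equal index land off the diagonal
      and vanish; those of adjacent index land on the diagonal, where \<open>C k\<close> cancels
      \<open>matrix_inv (C k)\<close>.\<close>
    have "PL n z ** ?QR n - ?QL n ** PR n z = 0" "PL k z ** ?QR k - ?QL k ** PR k z = 0"
      "PL n z ** ?QR k - ?QL n ** PR k z = - matrix_inv (C k)"
      "PL k z ** ?QR n - ?QL k ** PR n z = matrix_inv (C k)"
      using cross[of n n] cross[of k k] cross[of n k] cross[of k n] by (simp_all add: Suc)
    then have eqs: "PL n z ** ?QR n = ?QL n ** PR n z" "PL k z ** ?QR k = ?QL k ** PR k z"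
      "PL n z ** ?QR k = ?QL n ** PR k z - matrix_inv (C k)"
      "PL k z ** ?QR n = ?QL k ** PR n z + matrix_inv (C k)"
      by (simp_all add: algebra_simps)
    have "PL n z ** (- (- (?QR k ** C k))) = ?QL n ** (PR k z ** C k) - mat 1"
      by (simp add: matrix_mul_assoc eqs matrix_diff_rdistrib C)
    moreover have "C k ** PL k z ** ?QR n = C k ** ?QL k ** PR n z + mat 1"
      by (simp add: matrix_mul_assoc[symmetric] eqs matrix_add_ldistrib C)
    moreover have "C k ** PL k z ** (?QR k ** C k) = C k ** ?QL k ** (PR k z ** C k)"
      by (metis eqs(2) matrix_mul_assoc)
    \<comment> \<open>The double negation is deliberate: the upper right block of \<open>Y_R\<close>
      is itself a negative, and the rule expects its negation.\<close>
    ultimately have "block_matrix (PL n z) (?QL n) (- (C k ** PL k z)) (- (C k ** ?QL k)) **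
        block_matrix (- (?QR k ** C k)) (- ?QR n) (- (- (PR k z ** C k))) (PR n z) = mat 1"
      by (simp add: block_matrix_mult block_matrix_eq_one_iff matrix_mult_minus_left
          matrix_mult_minus_right eqs)
    from invertible_block_adjugate[OF this] show ?thesis
      by (simp add: Suc)
  qed
  then show "invertible (Y_L \<gamma> W PL C n z)" "invertible (Y_R \<gamma> W PR C n z)"
    by auto
qed

section \<open>Holomorphy of \<open>Y_L\<close> and \<open>Y_R\<close> off the curve\<close>

lemma Y_L_holomorphic_on:
  fixes W :: "complex \<Rightarrow> complex^'n^'n"
  assumes \<gamma>: "laguerre_curve \<gamma>" and W: "\<And>n. curve_integrable \<gamma> (\<lambda>z. z ^ n *\<^sub>m W z)"
    and P: "\<And>n. monic_matrix_poly n (P n)"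
  shows "Y_L \<gamma> W P C n matrix_holomorphic_on - \<gamma> ` {0..}"
proof -
  have Q: "second_kind_L \<gamma> W (P k) matrix_holomorphic_on - \<gamma> ` {0..}" for k
    unfolding second_kind_L_def
    using matrix_holomorphic_on_Cauchy[OF \<gamma>] curve_integrable_poly_left[OF W P, of 0 k] by simp
  note P' = monic_matrix_poly_holomorphic_on[OF P]
  \<comment> \<open>The defining equations speak of values at \<open>z\<close>; abstracting over
    \<open>z\<close> exposes the blocks as functions to the holomorphy rules.\<close>
  have "Y_L \<gamma> W P C n = (case n of
      0 \<Rightarrow> \<lambda>z. block_matrix (P 0 z) (second_kind_L \<gamma> W (P 0) z) 0 (mat 1)
    | Suc k \<Rightarrow> \<lambda>z. block_matrix (P n z) (second_kind_L \<gamma> W (P n) z)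
        (- (C k ** P k z)) (- (C k ** second_kind_L \<gamma> W (P k) z)))"
    by (cases n) auto
  then show ?thesis
    by (auto split: nat.split intro!: matrix_holomorphic_on_block matrix_holomorphic_on_minus
        matrix_holomorphic_on_mult matrix_holomorphic_on_const P' Q)
qed

lemma Y_R_holomorphic_on:
  fixes W :: "complex \<Rightarrow> complex^'n^'n"
  assumes \<gamma>: "laguerre_curve \<gamma>" and W: "\<And>n. curve_integrable \<gamma> (\<lambda>z. z ^ n *\<^sub>m W z)"
    and P: "\<And>n. monic_matrix_poly n (P n)"
  shows "Y_R \<gamma> W P C n matrix_holomorphic_on - \<gamma> ` {0..}"
proof -
  have Q: "second_kind_R \<gamma> W (P k) matrix_holomorphic_on - \<gamma> ` {0..}" for k
    unfolding second_kind_R_def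
    using matrix_holomorphic_on_Cauchy[OF \<gamma>] curve_integrable_poly_right[OF W P, of 0 k] by simp
  note P' = monic_matrix_poly_holomorphic_on[OF P]
  have "Y_R \<gamma> W P C n = (case n of
      0 \<Rightarrow> \<lambda>z. block_matrix (P 0 z) 0 (second_kind_R \<gamma> W (P 0) z) (mat 1)
    | Suc k \<Rightarrow> \<lambda>z. block_matrix (P n z) (- (P k z ** C k))
        (second_kind_R \<gamma> W (P n) z) (- (second_kind_R \<gamma> W (P k) z ** C k)))"
    by (cases n) auto
  then show ?thesis
    by (auto split: nat.split intro!: matrix_holomorphic_on_block matrix_holomorphic_on_minus
        matrix_holomorphic_on_mult matrix_holomorphic_on_const P' Q)
qed

section \<open>Structure matrices of products\<close>

lemma structure_matrix_L_mult:
  fixes Y D :: "complex \<Rightarrow> complex^'m^'m"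
  assumes Y: "Y matrix_holomorphic_on S" and D: "D matrix_holomorphic_on S"
    and S: "open S" "z \<in> S" and inv: "invertible (Y z)" "invertible (D z)"
    and D': "z *\<^sub>m matrix_deriv D z = B ** D z"
  shows "z *\<^sub>m matrix_deriv Y z + Y z ** B = (z *\<^sub>m structure_matrix_L (\<lambda>z. Y z ** D z) z) ** Y z"
proof -
  let ?Z = "Y z ** D z"
  \<comment> \<open>Reading this as a right inverse of \<open>Y z\<close> and exchanging factors
    shows that \<open>D z\<close> times the inverse of \<open>Z\<close> cancels \<open>Y z\<close>,
    with no formula for the inverse of a product.\<close>
  have "Y z ** (D z ** matrix_inv ?Z) = mat 1"
    using matrix_inv_cancel(1)[OF invertible_mult[OF inv]] by (simp add: matrix_mul_assoc)
  then have cancel: "D z ** matrix_inv ?Z ** Y z = mat 1"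
    using matrix_left_right_inverse by blast
  have "z *\<^sub>m matrix_deriv (\<lambda>z. Y z ** D z) z = (z *\<^sub>m matrix_deriv Y z + Y z ** B) ** D z"
    by (simp add: matrix_deriv_mult[OF Y D S] smult_matrix_add smult_matrix_mult_left matrix_add_rdistrib
        smult_matrix_mult_right[symmetric] D' matrix_mul_assoc)
  then have "(z *\<^sub>m structure_matrix_L (\<lambda>z. Y z ** D z) z) ** Y z =
      (z *\<^sub>m matrix_deriv Y z + Y z ** B) ** (D z ** matrix_inv ?Z ** Y z)"
    by (simp add: structure_matrix_L_def smult_matrix_mult_left[symmetric] matrix_mul_assoc)
  then show ?thesis
    by (simp add: cancel)
qed

lemma structure_matrix_R_mult:
  fixes Y D :: "complex \<Rightarrow> complex^'m^'m"
  assumes Y: "Y matrix_holomorphic_on S" and D: "D matrix_holomorphic_on S"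
    and S: "open S" "z \<in> S" and inv: "invertible (Y z)" "invertible (D z)"
    and D': "z *\<^sub>m matrix_deriv D z = D z ** B"
  shows "z *\<^sub>m matrix_deriv Y z + B ** Y z = Y z ** (z *\<^sub>m structure_matrix_R (\<lambda>z. D z ** Y z) z)"
proof -
  let ?Z = "D z ** Y z"
  have "(matrix_inv ?Z ** D z) ** Y z = mat 1"
    using matrix_inv_cancel(2)[OF invertible_mult[OF inv(2,1)]] by (simp add: matrix_mul_assoc)
  then have cancel: "Y z ** (matrix_inv ?Z ** D z) = mat 1"
    using matrix_left_right_inverse by blast
  have "z *\<^sub>m matrix_deriv (\<lambda>z. D z ** Y z) z = D z ** (z *\<^sub>m matrix_deriv Y z + B ** Y z)"
    by (simp add: matrix_deriv_mult[OF D Y S] smult_matrix_add smult_matrix_mult_right matrix_add_ldistrib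
        smult_matrix_mult_left[symmetric] D' matrix_mul_assoc add.commute)
  then have "Y z ** (z *\<^sub>m structure_matrix_R (\<lambda>z. D z ** Y z) z) =
      Y z ** (matrix_inv ?Z ** D z) ** (z *\<^sub>m matrix_deriv Y z + B ** Y z)"
    by (simp add: structure_matrix_R_def smult_matrix_mult_right[symmetric] matrix_mul_assoc)
  then show ?thesis
    by (simp add: cancel)
qed

text \<open>Inversion moves the coefficient to the other side and changes its sign: if z V' = V v,
  then z (V^{-1})' = - V^{-1} (V v) V^{-1} = - v V^{-1}. Thus both diagonal blocks get their
  coefficient on the same side. The last two claims are the mirror cases for the left and the right
  problem.\<close>

lemma block_diagonal_deriv:
  fixes U V :: "complex \<Rightarrow> complex^'n^'n"
  assumes U: "U matrix_holomorphic_on S" and V: "V matrix_holomorphic_on S"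
    and inv: "\<forall>z\<in>S. invertible (U z)" "\<forall>z\<in>S. invertible (V z)"
    and S: "open S" "z \<in> S"
  defines "D \<equiv> \<lambda>z. block_matrix (U z) 0 0 (matrix_inv (V z))"
  shows "D matrix_holomorphic_on S" "invertible (D z)"
    and "z *\<^sub>m matrix_deriv U z = u ** U z \<Longrightarrow> z *\<^sub>m matrix_deriv V z = V z ** v \<Longrightarrow>
      z *\<^sub>m matrix_deriv D z = block_matrix u 0 0 (- v) ** D z"
    and "z *\<^sub>m matrix_deriv U z = U z ** u' \<Longrightarrow> z *\<^sub>m matrix_deriv V z = v' ** V z \<Longrightarrow>
      z *\<^sub>m matrix_deriv D z = D z ** block_matrix u' 0 0 (- v')"
proof -
  show "D matrix_holomorphic_on S"
    unfolding D_def by (intro matrix_holomorphic_on_block matrix_holomorphic_on_const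
        matrix_holomorphic_on_inv U V inv(2)[rule_format])
  have "D z ** block_matrix (matrix_inv (U z)) 0 0 (V z) = mat 1"
    by (simp add: D_def block_matrix_mult block_matrix_eq_one_iff matrix_inv_cancel inv S)
  then show "invertible (D z)"
    using invertible_right_inverse by blast
  have D': "z *\<^sub>m matrix_deriv D z = block_matrix (z *\<^sub>m matrix_deriv U z) 0 0
      (- (matrix_inv (V z) ** (z *\<^sub>m matrix_deriv V z) ** matrix_inv (V z)))"
    by (simp add: D_def matrix_deriv_block smult_block_matrix matrix_deriv_inv[OF V inv(2)[rule_format] S]
        smult_matrix_minus smult_matrix_mult_left smult_matrix_mult_right)
  show "z *\<^sub>m matrix_deriv D z = block_matrix u 0 0 (- v) ** D z"
    if "z *\<^sub>m matrix_deriv U z = u ** U z" "z *\<^sub>m matrix_deriv V z = V z ** v"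
    unfolding D' that
    by (simp add: D_def block_matrix_mult matrix_mult_minus_left matrix_mul_assoc matrix_inv_cancel inv S)
  show "z *\<^sub>m matrix_deriv D z = D z ** block_matrix u' 0 0 (- v')"
    if "z *\<^sub>m matrix_deriv U z = U z ** u'" "z *\<^sub>m matrix_deriv V z = v' ** V z"
    unfolding D' that
    by (simp add: D_def block_matrix_mult matrix_mult_minus_right matrix_mul_assoc[symmetric]
        matrix_inv_cancel inv S)
qed

theorem proposition4:
  fixes \<gamma> :: "real \<Rightarrow> complex"
    and lg :: "complex \<Rightarrow> complex"
    and hL hR WL WR W :: "complex \<Rightarrow> complex^'n^'n"
    and PL PR :: "nat \<Rightarrow> complex \<Rightarrow> complex^'n^'n"
    and C :: "nat \<Rightarrow> complex^'n^'n"
    and YL YR ZL ZR M_L M_R Mt_L Mt_R :: "nat \<Rightarrow> complex \<Rightarrow> complex^('n + 'n)^('n + 'n)"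
  assumes curve: "laguerre_curve \<gamma>"
    and log: "log_branch \<gamma> lg"
    and pearson: "pearson_L \<gamma> lg hL WL" "pearson_R \<gamma> lg hR WR"
    and weight: "\<And>t. t > 0 \<Longrightarrow> has_left_value \<gamma> (\<lambda>z. WL z ** WR z) t (W (\<gamma> t))"
    and laguerre: "laguerre_weight \<gamma> lg W"
    and regular: "regular_weight \<gamma> W"
    and biorth: "biorthogonal \<gamma> W PL PR C"
  defines "YL \<equiv> Y_L \<gamma> W PL C"
    and "YR \<equiv> Y_R \<gamma> W PR C"
    and "ZL \<equiv> \<lambda>n. Z_L WL WR (YL n)"
    and "ZR \<equiv> \<lambda>n. Z_R WL WR (YR n)"
    and "M_L \<equiv> \<lambda>n. structure_matrix_L (ZL n)"
    and "M_R \<equiv> \<lambda>n. structure_matrix_R (ZR n)"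
    and "Mt_L \<equiv> \<lambda>n z. z *\<^sub>m M_L n z"
    and "Mt_R \<equiv> \<lambda>n z. z *\<^sub>m M_R n z"
  shows "\<forall>n. \<forall>z. z \<notin> \<gamma> ` {0..} \<longrightarrow>
      z *\<^sub>m matrix_deriv (YL n) z + YL n z ** block_matrix (hL z) 0 0 (- hR z)
        = Mt_L n z ** YL n z \<and>
      z *\<^sub>m matrix_deriv (YR n) z + block_matrix (hR z) 0 0 (- hL z) ** YR n z
        = YR n z ** Mt_R n z"
proof (intro allI impI)
  fix n z assume z: "z \<notin> \<gamma> ` {0..}"
  define S where "S = - \<gamma> ` {0..}"
  have S: "open S" "z \<in> S"
    using closed_laguerre_curve[OF curve] z by (auto simp: S_def)
  have W: "\<And>n. curve_integrable \<gamma> (\<lambda>z. z ^ n *\<^sub>m W z)"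
    using laguerre by (simp add: laguerre_weight_def)
  have monic: "\<And>n. monic_matrix_poly n (PL n)" "\<And>n. monic_matrix_poly n (PR n)"
    using biorth unfolding biorthogonal_def by blast+
  have YL: "YL n matrix_holomorphic_on S" and YR: "YR n matrix_holomorphic_on S"
    unfolding YL_def YR_def S_def
    by (intro Y_L_holomorphic_on Y_R_holomorphic_on curve W monic)+
  have inv_Y: "invertible (YL n z)" "invertible (YR n z)"
    unfolding YL_def YR_def by (intro invertible_Y[OF curve W biorth z])+
  have hol: "WL matrix_holomorphic_on S" "WR matrix_holomorphic_on S"
    and inv: "\<forall>z\<in>S. invertible (WL z)" "\<forall>z\<in>S. invertible (WR z)"
    and eq: "z *\<^sub>m matrix_deriv WL z = hL z ** WL z" "z *\<^sub>m matrix_deriv WR z = WR z ** hR z"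
    using pearson z unfolding pearson_L_def pearson_R_def S_def by auto
  note DL = block_diagonal_deriv[OF hol inv S]
    \<comment> \<open>In \<open>Z_R\<close> the diagonal blocks are \<open>WR\<close> and the
      inverse of \<open>WL\<close>, so the two solutions exchange roles.\<close>
    and DR = block_diagonal_deriv[OF hol(2,1) inv(2,1) S]
  have "z *\<^sub>m matrix_deriv (YL n) z + YL n z ** block_matrix (hL z) 0 0 (- hR z) = Mt_L n z ** YL n z"
    unfolding Mt_L_def M_L_def ZL_def Z_L_def
    by (rule structure_matrix_L_mult[OF YL DL(1) S inv_Y(1) DL(2) DL(3)[OF eq]])
  moreover have "z *\<^sub>m matrix_deriv (YR n) z + block_matrix (hR z) 0 0 (- hL z) ** YR n z =
      YR n z ** Mt_R n z"
    unfolding Mt_R_def M_R_def ZR_def Z_R_def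
    by (rule structure_matrix_R_mult[OF YR DR(1) S inv_Y(2) DR(2) DR(4)[OF eq(2,1)]])
  ultimately show "z *\<^sub>m matrix_deriv (YL n) z + YL n z ** block_matrix (hL z) 0 0 (- hR z)
        = Mt_L n z ** YL n z \<and>
      z *\<^sub>m matrix_deriv (YR n) z + block_matrix (hR z) 0 0 (- hL z) ** YR n z
        = YR n z ** Mt_R n z"
    by blast
qed

end
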